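(* (Bifurcation Theorem) Let $N$ be a $2p\times 2p$ real positive definite matrix having the SSSP. Then there exists $\epsilon>0$ such that if $\widehat N$ is a $2p\times 2p$ positive definite matrix with $\|\widehat N-N\|<\epsilon$, then there exists a positive definite matrix $N'$ with the same labeled graph as $N$ (i.e. $N'\in\mathcal S_+(\mathcal G^L(N))$) whose symplectic spectrum equals the symplectic spectrum of $\widehat N$.
   Context: $\Omega=\begin{bmatrix}O&I_p\\ -I_p&O\end{bmatrix}$; a real $2p\times2p$ matrix $S$ is symplectic if $S^\top\Omega S=\Omega$. Positive definite matrices are real symmetric. By Williamson's theorem, for each $2p\times 2p$ positive definite $N$ there is a symplectic $S$ with $S^\top NS=D\oplus D$, $D$ a $p\times p$ diagonal matrix whose diagonal entries are positive and unique up to order; the multiset of these $p$ numbers is the symplectic spectrum of $N$. $\|\cdot\|$ denotes any fixed induced matrix norm (e.g. the spectral norm). Labeled graphs of order $2p$ are simple graphs on vertex set $\{1,\dots,2p\}$. The labeled graph $\mathcal G^L(N)$ of a positive definite $N=[n_{ij}]$ has edges $\{ij: i\ne j,\ n_{ij}\neq0\}$. For a labeled graph $G^L$, $\mathcal S(G^L)$ is the set of real symmetric matrices $A=[a_{ij}]$ such that for $i\ne j$, $a_{ij}\ne0$ if and only if $ij$ is an edge (diagonal entries arbitrary), and $\mathcal S_+(G^L)$ is the set of positive definite matrices with labeled graph $G^L$. $\mathfrak{sp}(2p)$ is the space of Hamiltonian matrices $\begin{bmatrix}R&E\\ F&-R^\top\end{bmatrix}$ with $R,E,F$ real $p\times p$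 and $E,F$ symmetric. $\mathrm{Symm}(2p)$ is the space of real symmetric $2p\times2p$ matrices. A positive definite $2p\times 2p$ matrix $N$ has the Strong Symplectic Spectral Property (SSSP) if $$\{NM+M^\top N: M\in\mathfrak{sp}(2p)\}+\operatorname{Span}\mathcal S(\mathcal G^L(N))=\mathrm{Symm}(2p).$$ *)

theory Defs
  imports "HOL-Analysis.Analysis"
begin

text \<open>A \<open>2p \<times> 2p\<close> matrix is indexed by the sum type \<open>'p + 'p\<close> with \<open>CARD('p) = p\<close>: the indices
  \<open>1, \<dots>, p\<close> are the \<open>Inl i\<close> and the indices \<open>p + 1, \<dots>, 2p\<close> are the \<open>Inr i\<close>. Hence \<open>'p + 'p\<close>
  is also the vertex set of the labeled graphs of order \<open>2p\<close>.\<close>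

type_synonym 'p sqmat = "real^'p^'p"
type_synonym 'p sqmat2 = "real^('p + 'p)^('p + 'p)"

definition block_mat ::
  "'p::finite sqmat \<Rightarrow> 'p sqmat \<Rightarrow> 'p sqmat \<Rightarrow> 'p sqmat \<Rightarrow> 'p sqmat2"
  where "block_mat A B C D = (\<chi> i j.
    case i of
      Inl k \<Rightarrow> (case j of Inl l \<Rightarrow> A $ k $ l | Inr l \<Rightarrow> B $ k $ l)
    | Inr k \<Rightarrow> (case j of Inl l \<Rightarrow> C $ k $ l | Inr l \<Rightarrow> D $ k $ l))"

definition Omega :: "'p::finite sqmat2"
  where "Omega = block_mat 0 (mat 1) (- mat 1) 0"

definition symplectic :: "'p::finite sqmat2 \<Rightarrow> bool"
  where "symplectic S \<longleftrightarrow> transpose S ** Omega ** S = Omega"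

definition Symm :: "(real^'n^'n) set"
  where "Symm = {A. transpose A = A}"

definition pos_def :: "real^'n^'n \<Rightarrow> bool"
  where "pos_def N \<longleftrightarrow> N \<in> Symm \<and> (\<forall>x. x \<noteq> 0 \<longrightarrow> x \<bullet> (N *v x) > 0)"

definition diag_mat :: "real^'n \<Rightarrow> real^'n^'n"
  where "diag_mat d = (\<chi> i j. if i = j then d $ i else 0)"

text \<open>The description below determines a unique multiset for every positive definite matrix, by
  Williamson's theorem.\<close>

definition symplectic_spectrum :: "'p::finite sqmat2 \<Rightarrow> real multiset"
  where "symplectic_spectrum N = (THE m. \<exists>S d.
    symplectic S \<and> (\<forall>i. d $ i > 0) \<and>
    transpose S ** N ** S = block_mat (diag_mat d) 0 0 (diag_mat d) \<and>
    m = image_mset (\<lambda>i. d $ i) (mset_set UNIV))"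

text \<open>A labeled graph is represented by its set of edges \<open>{i, j}\<close>; its vertex set is the whole
  index type.\<close>

type_synonym 'n labeled_graph = "'n set set"

definition graph_of :: "real^'n^'n \<Rightarrow> 'n labeled_graph"
  where "graph_of N = {{i, j} |i j. i \<noteq> j \<and> N $ i $ j \<noteq> 0}"

definition S_mats :: "'n labeled_graph \<Rightarrow> (real^'n^'n) set"
  where "S_mats G = {A \<in> Symm. \<forall>i j. i \<noteq> j \<longrightarrow> (A $ i $ j \<noteq> 0 \<longleftrightarrow> {i, j} \<in> G)}"

definition S_plus :: "'n labeled_graph \<Rightarrow> (real^'n^'n) set"
  where "S_plus G = {A. pos_def A \<and> graph_of A = G}"

definition hamiltonian_mats :: "'p::finite sqmat2 set"
  where "hamiltonian_mats =
    {block_mat R E F (- transpose R) |R E F. E \<in> Symm \<and> F \<in> Symm}"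

definition SSSP :: "'p::finite sqmat2 \<Rightarrow> bool"
  where "SSSP N \<longleftrightarrow>
    {N ** M + transpose M ** N |M. M \<in> hamiltonian_mats} + span (S_mats (graph_of N)) = Symm"

definition vector_norm :: "(real^'n \<Rightarrow> real) \<Rightarrow> bool"
  where "vector_norm \<nu> \<longleftrightarrow>
    (\<forall>x. \<nu> x = 0 \<longleftrightarrow> x = 0) \<and> (\<forall>c x. \<nu> (c *\<^sub>R x) = \<bar>c\<bar> * \<nu> x) \<and>
    (\<forall>x y. \<nu> (x + y) \<le> \<nu> x + \<nu> y)"

definition induced_matrix_norm :: "(real^'n^'n \<Rightarrow> real) \<Rightarrow> bool"
  where "induced_matrix_norm \<mu> \<longleftrightarrow>
    (\<exists>\<nu>. vector_norm \<nu> \<and> (\<forall>A. \<mu> A = (SUP x\<in>{x. \<nu> x = 1}. \<nu> (A *v x))))"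

text \<open>The spectral norm is an instance.\<close>

lemma induced_matrix_norm_spectral:
  "induced_matrix_norm (\<lambda>A :: real^'n^'n. onorm ((*v) A))"
  unfolding induced_matrix_norm_def
proof (intro exI[of _ norm] conjI allI)
  show "vector_norm (norm :: real^'n \<Rightarrow> real)"
    by (simp add: vector_norm_def norm_triangle_ineq)
  fix A :: "real^'n^'n"
  have bl: "bounded_linear ((*v) A)"
    by (rule matrix_vector_mul_bounded_linear)
  have ne: "{x :: real^'n. norm x = 1} \<noteq> {}"
    using norm_axis_1 by blast
  have le: "norm (A *v x) \<le> onorm ((*v) A)" if "norm x = 1" for x
    using onorm[OF bl, of x] that by simp
  have bdd: "bdd_above ((\<lambda>x. norm (A *v x)) ` {x. norm x = 1})"
    using le by (auto intro!: bdd_aboveI)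
  show "onorm ((*v) A) = (SUP x\<in>{x. norm x = 1}. norm (A *v x))"
  proof (rule antisym)
    show "(SUP x\<in>{x. norm x = 1}. norm (A *v x)) \<le> onorm ((*v) A)"
      by (rule cSUP_least[OF ne]) (auto intro: le)
    have nn: "0 \<le> (SUP x\<in>{x. norm x = 1}. norm (A *v x))"
      using ne by (auto intro!: cSUP_upper2[OF bdd])
    show "onorm ((*v) A) \<le> (SUP x\<in>{x. norm x = 1}. norm (A *v x))"
    proof (rule onorm_bound[OF nn])
      fix x :: "real^'n"
      show "norm (A *v x) \<le> (SUP x\<in>{x. norm x = 1}. norm (A *v x)) * norm x"
      proof (cases "x = 0")
        case False
        let ?y = "(1 / norm x) *\<^sub>R x"
        have "norm (A *v ?y) \<le> (SUP x\<in>{x. norm x = 1}. norm (A *v x))"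
          using False by (intro cSUP_upper[OF _ bdd]) auto
        moreover have "norm (A *v ?y) = norm (A *v x) / norm x"
          by (simp add: matrix_vector_mult_scaleR)
        ultimately show ?thesis
          using False by (simp add: field_simps)
      qed simp
    qed
  qed
qed

end

theory Submission
  imports Defs
begin

text \<open>Write \<open>G\<close> for the labeled graph of \<open>N\<close>. A symplectic congruence does not change the symplectic
  spectrum (\<open>symplectic_spectrum_congruence\<close>), so it suffices to write each positive definite
  \<open>N_hat\<close> near \<open>N\<close> as \<open>transpose S ** (N + B) ** S\<close> with \<open>S\<close> symplectic and \<open>B\<close> a small element of
  the span of \<open>S_mats G\<close>: then \<open>N' = N + B\<close> has the pattern \<open>G\<close>, because \<open>B\<close> vanishes on the
  non-edges and is too small to cancel an entry on an edge (\<open>graph_of_perturbation\<close>), and it is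
  positive definite because it is congruent to \<open>N_hat\<close>.

  Near the identity, symplectic matrices are parametrized by Hamiltonian matrices through the
  Cayley transform \<open>S = (I + M/2) (I - M/2)\<^sup>-\<^sup>1\<close>, whose derivative at \<open>M = 0\<close> is the identity. The
  derivative at \<open>(0, 0)\<close> of \<open>(M, B) \<mapsto> transpose S ** (N + B) ** S\<close> is therefore
  \<open>(M, B) \<mapsto> N ** M + transpose M ** N + B\<close>, and the SSSP says exactly that it maps onto the
  symmetric matrices. A continuous map with a surjective derivative at one point is open there
  (Sussmann's open mapping theorem, a consequence of Brouwer's theorem), so every symmetric matrix
  near \<open>N\<close> is reached with \<open>M\<close> and \<open>B\<close> small (\<open>SSSP_local_normal_form\<close>).

  The neighbourhood so obtained is measured in the Euclidean norm of the matrix entries; it is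
  converted to the given induced norm by \<open>induced_matrix_norm_dominates\<close>.\<close>

section \<open>Matrix calculus\<close>

lemma bounded_bilinear_matrix_mult:
  "bounded_bilinear ((**) :: real^'m^'n \<Rightarrow> real^'l^'m \<Rightarrow> real^'l^'n)"
  unfolding bilinear_conv_bounded_bilinear[symmetric] bilinear_def linear_iff
  by (auto simp: matrix_add_ldistrib matrix_scalar_ac scalar_matrix_assoc)
    (simp_all add: matrix_matrix_mult_def vec_eq_iff algebra_simps sum.distrib)

interpretation matrix_mult: bounded_bilinear
  "(**) :: real^'m^'n \<Rightarrow> real^'l^'m \<Rightarrow> real^'l^'n"
  by (rule bounded_bilinear_matrix_mult)

lemma bounded_linear_transpose: "bounded_linear (transpose :: real^'m^'n \<Rightarrow> real^'n^'m)"
  unfolding linear_conv_bounded_linear[symmetric]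
  by (rule linearI) (simp_all add: transpose_def vec_eq_iff)

lemmas linear_transpose = bounded_linear.linear[OF bounded_linear_transpose]
lemmas transpose_zero = linear_0[OF linear_transpose]
lemmas transpose_add = linear_add[OF linear_transpose]
lemmas transpose_diff = linear_diff[OF linear_transpose]

lemma matrix_inv_works:
  fixes B :: "real^'n^'n"
  assumes "invertible B"
  shows "B ** matrix_inv B = mat 1" and "matrix_inv B ** B = mat 1"
proof -
  have "B ** matrix_inv B = mat 1 \<and> matrix_inv B ** B = mat 1"
    unfolding matrix_inv_def using assms unfolding invertible_def by (rule someI_ex)
  then show "B ** matrix_inv B = mat 1" and "matrix_inv B ** B = mat 1"
    by auto
qed

lemma matrix_inv_cramer:
  fixes B :: "real^'n^'n"
  assumes "invertible B"
  shows "matrix_inv B =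
    (\<chi> i j. det (\<chi> a b. if b = i then axis j 1 $ a else B $ a $ b) / det B)"
proof -
  have "B *v (\<chi> i. matrix_inv B $ i $ j) = axis j 1" for j
    using arg_cong[OF matrix_inv_works(1)[OF assms], of "column j"]
    by (simp add: vec_eq_iff column_def matrix_matrix_mult_def matrix_vector_mult_def mat_def axis_def)
  then have "(\<chi> i. matrix_inv B $ i $ j) =
      (\<chi> i. det (\<chi> a b. if b = i then axis j 1 $ a else B $ a $ b) / det B)" for j
    using cramer[of B] assms by (simp add: invertible_det_nz)
  then show ?thesis
    by (simp add: vec_eq_iff)
qed

lemma continuous_on_det [continuous_intros]:
  fixes f :: "'a::topological_space \<Rightarrow> real^'n^'n"
  assumes "continuous_on S f"
  shows "continuous_on S (\<lambda>x. det (f x))"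
  unfolding det_def using assms by (intro continuous_intros)

lemma open_invertible: "open {B :: real^'n^'n. invertible B}"
proof -
  have "open ((\<lambda>B :: real^'n^'n. det B) -` (- {0}))"
    by (intro open_vimage continuous_intros)
  moreover have "(\<lambda>B :: real^'n^'n. det B) -` (- {0}) = {B. invertible B}"
    by (auto simp: invertible_det_nz)
  ultimately show ?thesis by simp
qed

text \<open>Cramer's rule writes the entries of the inverse as quotients of polynomials in the entries of
  the matrix.\<close>

lemma continuous_on_matrix_inv:
  "continuous_on {B :: real^'n^'n. invertible B} matrix_inv"
proof -
  have *: "continuous_on {B :: real^'n^'n. invertible B}
      (\<lambda>B. if b = i then c else B $ a $ b)" for a b i c
    by (cases "b = i") (auto intro!: continuous_intros)
  have "continuous_on {B :: real^'n^'n. invertible B}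
      (\<lambda>B. \<chi> i j. det (\<chi> a b. if b = i then axis j 1 $ a else B $ a $ b) / det B)"
    by (intro continuous_intros *) (auto simp: invertible_det_nz)
  then show ?thesis
    by (rule continuous_on_eq) (simp add: matrix_inv_cramer)
qed

text \<open>The remainder term factors exactly: \<open>B\<^sup>-\<^sup>1 - A\<^sup>-\<^sup>1 + A\<^sup>-\<^sup>1 (B - A) A\<^sup>-\<^sup>1\<close> equals
  \<open>(A\<^sup>-\<^sup>1 - B\<^sup>-\<^sup>1) (B - A) A\<^sup>-\<^sup>1\<close>. Its first factor tends to \<open>0\<close> by continuity of the inverse, and
  its second is of order \<open>B - A\<close>.\<close>

lemma has_derivative_matrix_inv:
  fixes A :: "real^'n^'n"
  assumes A: "invertible A"
  shows "(matrix_inv has_derivative (\<lambda>H. - (matrix_inv A ** H ** matrix_inv A))) (at A)"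
proof -
  have bl: "bounded_linear (\<lambda>H. - (matrix_inv A ** H ** matrix_inv A))"
    by (intro bounded_linear_minus bounded_linear_compose[OF matrix_mult.bounded_linear_left]
        matrix_mult.bounded_linear_right)
  obtain K where K: "\<And>a b. norm ((a :: real^'n^'n) ** (b :: real^'n^'n)) \<le> norm a * norm b * K"
    and "K > 0"
    using matrix_mult.pos_bounded by blast
  have rem: "matrix_inv B - matrix_inv A - - (matrix_inv A ** (B - A) ** matrix_inv A)
      = (matrix_inv A - matrix_inv B) ** (B - A) ** matrix_inv A" if "invertible B" for B
  proof -
    have "matrix_inv B ** A ** matrix_inv A = matrix_inv B"
      by (simp add: matrix_inv_works(1)[OF A] flip: matrix_mul_assoc)
    then show ?thesis
      unfolding matrix_mult.diff_left matrix_mult.diff_right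
      by (simp add: matrix_inv_works[OF A] matrix_inv_works[OF that])
  qed
  have cont: "(matrix_inv \<longlongrightarrow> matrix_inv A) (at A)"
    using continuous_on_matrix_inv open_invertible A
    by (metis continuous_on_eq_continuous_at continuous_at mem_Collect_eq)
  have lim: "((\<lambda>B. norm (matrix_inv A - matrix_inv B) * K * norm (matrix_inv A) * K) \<longlongrightarrow> 0) (at A)"
    by (rule tendsto_eq_intros cont refl)+ simp
  have "((\<lambda>B. norm (matrix_inv B - matrix_inv A - - (matrix_inv A ** (B - A) ** matrix_inv A))
      / norm (B - A)) \<longlongrightarrow> 0) (at A)"
  proof (rule tendsto_sandwich[OF _ _ tendsto_const lim])
    have "\<forall>\<^sub>F B in at A. invertible B"
      using eventually_at_topological open_invertible A by blast
    then show "\<forall>\<^sub>F B in at A.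
        norm (matrix_inv B - matrix_inv A - - (matrix_inv A ** (B - A) ** matrix_inv A)) / norm (B - A)
        \<le> norm (matrix_inv A - matrix_inv B) * K * norm (matrix_inv A) * K"
    proof eventually_elim
      case (elim B)
      have "norm ((matrix_inv A - matrix_inv B) ** (B - A) ** matrix_inv A)
          \<le> (norm (matrix_inv A - matrix_inv B) * norm (B - A) * K) * norm (matrix_inv A) * K"
        using K \<open>K > 0\<close> by (meson order_trans mult_right_mono norm_ge_zero less_imp_le)
      then show ?case
        unfolding rem[OF elim] using \<open>K > 0\<close>
        by (cases "B = A") (auto simp: divide_le_eq mult_ac)
    qed
  qed simp
  then show ?thesis
    using bl by (simp add: has_derivative_iff_norm)
qed

section \<open>Symplectic matrices\<close>

lemma sum_UNIV_plus:
  fixes f :: "'a::finite + 'b::finite \<Rightarrow> 'c::comm_monoid_add"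
  shows "sum f UNIV = (\<Sum>i\<in>UNIV. f (Inl i)) + (\<Sum>i\<in>UNIV. f (Inr i))"
  unfolding UNIV_Plus_UNIV[symmetric] by (subst sum.Plus) auto

lemma Omega_mult_nth:
  "(Omega ** M) $ Inl k = M $ Inr k" "(Omega ** M) $ Inr k = - M $ Inl k"
  by (simp_all add: vec_eq_iff matrix_matrix_mult_def sum_UNIV_plus Omega_def block_mat_def mat_def
      if_distrib if_distribR sum_negf cong: if_cong)

lemma Omega_Omega: "Omega ** Omega = - mat 1"
proof -
  have "(Omega ** Omega) $ i = (- mat 1 :: 'a sqmat2) $ i" for i :: "'a + 'a"
    by (cases i) (auto simp: Omega_mult_nth, auto simp: vec_eq_iff Omega_def block_mat_def mat_def
        split: sum.splits)
  then show ?thesis by (simp add: vec_eq_iff)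
qed

lemma transpose_Omega: "transpose Omega = - Omega"
  by (auto simp: vec_eq_iff Omega_def block_mat_def mat_def transpose_def split: sum.splits)

text \<open>\<open>Omega ** M\<close> is \<open>M\<close> with its block rows exchanged and one sign changed, so the block
  conditions on \<open>M\<close> become the symmetry of \<open>Omega ** M\<close>. In this form they are visibly linear and
  coordinate-free, and this is how Hamiltonian matrices enter all that follows.\<close>

lemma hamiltonian_imp_Omega_mult_Symm:
  assumes "M \<in> hamiltonian_mats"
  shows "Omega ** M \<in> Symm"
proof -
  obtain R E F where M: "M = block_mat R E F (- transpose R)" "transpose E = E" "transpose F = F"
    using assms by (auto simp: hamiltonian_mats_def Symm_def)
  have EF: "E $ i $ j = E $ j $ i" "F $ i $ j = F $ j $ i" for i j
    using M(2,3) by (metis transpose_def vec_lambda_beta)+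
  have "(Omega ** M) $ j $ i = (Omega ** M) $ i $ j" for i j
    by (cases i; cases j) (auto simp: Omega_mult_nth M(1) block_mat_def transpose_def EF)
  then show ?thesis
    by (simp add: Symm_def vec_eq_iff transpose_def)
qed

lemma subspace_Symm: "subspace (Symm :: (real^'n^'n) set)"
  by (auto simp: subspace_def Symm_def transpose_add transpose_scalar transpose_zero)

lemma subspace_Omega_mult_Symm: "subspace {M. Omega ** M \<in> Symm}"
  by (rule linear_subspace_vimage[unfolded vimage_def, OF _ subspace_Symm])
    (rule bounded_linear.linear[OF matrix_mult.bounded_linear_right])

lemma symplectic_mult:
  assumes "symplectic S" "symplectic T"
  shows "symplectic (S ** T)"
proof -
  have "transpose (S ** T) ** Omega ** (S ** T) = transpose T ** (transpose S ** Omega ** S) ** T"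
    by (simp add: matrix_transpose_mul matrix_mul_assoc)
  then show ?thesis
    using assms by (simp add: symplectic_def)
qed

text \<open>Since \<open>Omega\<^sup>2 = - I\<close>, the defining equation exhibits
  \<open>- (Omega ** transpose S ** Omega)\<close> as a left inverse of \<open>S\<close>.\<close>

lemma symplectic_inverse:
  assumes "symplectic S"
  obtains S' where "symplectic S'" "S ** S' = mat 1" "S' ** S = mat 1"
proof -
  define S' where "S' = - (Omega ** transpose S ** Omega)"
  have "S' ** S = - (Omega ** (transpose S ** Omega ** S))"
    by (simp add: S'_def matrix_mult.minus_left matrix_mul_assoc)
  also have "\<dots> = mat 1"
    using assms by (simp add: symplectic_def Omega_Omega)
  finally have l: "S' ** S = mat 1" .
  then have r: "S ** S' = mat 1"
    by (rule matrix_left_right_inverse1)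
  have "transpose S' ** Omega ** S' = transpose S' ** (transpose S ** Omega ** S) ** S'"
    using assms by (simp add: symplectic_def)
  also have "\<dots> = transpose (S ** S') ** Omega ** (S ** S')"
    by (simp add: matrix_transpose_mul matrix_mul_assoc)
  also have "\<dots> = Omega"
    by (simp add: r)
  finally show thesis
    using that l r by (simp add: symplectic_def)
qed

text \<open>The diagonal forms reachable from \<open>transpose T ** N ** T\<close> by a symplectic \<open>S\<close> are those
  reachable from \<open>N\<close> by \<open>T ** S\<close>, and \<open>S \<mapsto> T ** S\<close> is a bijection of the symplectic matrices. So
  both spectra are described by the same predicate on multisets.\<close>

lemma symplectic_spectrum_congruence:
  fixes N T :: "'p::finite sqmat2"
  assumes "symplectic T"
  shows "symplectic_spectrum (transpose T ** N ** T) = symplectic_spectrum N"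
proof -
  obtain T' where T': "symplectic T'" "T ** T' = mat 1"
    using symplectic_inverse[OF assms] by blast
  have "(\<exists>S. symplectic S \<and> transpose S ** (transpose T ** N ** T) ** S = D)
      \<longleftrightarrow> (\<exists>S. symplectic S \<and> transpose S ** N ** S = D)" for D :: "'p sqmat2"
  proof safe
    fix S :: "'p sqmat2"
    assume "symplectic S" "D = transpose S ** (transpose T ** N ** T) ** S"
    then show "\<exists>U. symplectic U \<and> transpose U ** N ** U = transpose S ** (transpose T ** N ** T) ** S"
      using symplectic_mult[OF assms]
      by (intro exI[of _ "T ** S"]) (simp add: matrix_transpose_mul matrix_mul_assoc)
  next
    fix S :: "'p sqmat2"
    assume S: "symplectic S"
    have "transpose (T' ** S) ** (transpose T ** N ** T) ** (T' ** S)
        = transpose (T ** T' ** S) ** N ** (T ** T' ** S)"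
      by (simp add: matrix_transpose_mul matrix_mul_assoc)
    then show "\<exists>U. symplectic U \<and> transpose U ** (transpose T ** N ** T) ** U = transpose S ** N ** S"
      using symplectic_mult[OF T'(1) S] T'(2) by (intro exI[of _ "T' ** S"]) simp
  qed
  then show ?thesis
    unfolding symplectic_spectrum_def by (intro arg_cong[of _ _ The] ext) metis
qed

text \<open>The Cayley transform \<open>(I + M/2) (I - M/2)\<^sup>-\<^sup>1\<close>, rewritten with \<open>I + M/2 = 2 I - (I - M/2)\<close> so that
  \<open>M\<close> enters only through the inverse. The factor \<open>1/2\<close> normalizes the derivative at \<open>0\<close> to the
  identity.\<close>

definition cayley :: "real^'n^'n \<Rightarrow> real^'n^'n"
  where "cayley M = 2 *\<^sub>R matrix_inv (mat 1 - (1/2) *\<^sub>R M) - mat 1"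

text \<open>With \<open>P = I - M/2\<close> and \<open>Q = I + M/2\<close>, the Hamiltonian condition cancels the terms linear in
  \<open>M\<close>, so \<open>P\<close> and \<open>Q\<close> transform the form \<open>Omega\<close> in the same way; hence \<open>Q ** P\<^sup>-\<^sup>1\<close> preserves it.\<close>

lemma symplectic_cayley:
  fixes M :: "'p::finite sqmat2"
  assumes M: "Omega ** M \<in> Symm" and inv: "invertible (mat 1 - (1/2) *\<^sub>R M)"
  shows "symplectic (cayley M)"
proof -
  define P Q where "P = mat 1 - (1/2) *\<^sub>R M" and "Q = mat 1 + (1/2) *\<^sub>R M"
  have PX: "P ** matrix_inv P = mat 1"
    using inv matrix_inv_works unfolding P_def by blast
  have QX: "cayley M = Q ** matrix_inv P"
  proof -
    have "Q = 2 *\<^sub>R mat 1 - P"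
      by (simp add: P_def Q_def vec_eq_iff)
    then have "Q ** matrix_inv P = 2 *\<^sub>R matrix_inv P - mat 1"
      by (simp add: matrix_mult.diff_left matrix_mult.scaleR_left PX)
    then show ?thesis by (simp add: cayley_def P_def)
  qed
  have MO: "transpose M ** Omega = - (Omega ** M)"
  proof -
    have "transpose (Omega ** M) = Omega ** M"
      using M by (simp add: Symm_def)
    then have "- (transpose M ** Omega) = Omega ** M"
      by (simp add: matrix_transpose_mul transpose_Omega matrix_mult.minus_right)
    then show ?thesis by (simp add: minus_equation_iff)
  qed
  have PQ: "transpose Q ** Omega ** Q = transpose P ** Omega ** P"
    by (simp add: P_def Q_def transpose_add transpose_diff transpose_scalar
        matrix_mult.add_left matrix_mult.add_right matrix_mult.diff_left matrix_mult.diff_right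
        matrix_mult.scaleR_left matrix_mult.scaleR_right MO)
      (simp add: vec_eq_iff field_simps)
  have "transpose (cayley M) ** Omega ** cayley M
      = transpose (matrix_inv P) ** (transpose Q ** Omega ** Q) ** matrix_inv P"
    by (simp add: QX matrix_transpose_mul matrix_mul_assoc)
  also have "\<dots> = transpose (P ** matrix_inv P) ** Omega ** (P ** matrix_inv P)"
    by (simp add: PQ matrix_transpose_mul matrix_mul_assoc)
  finally show ?thesis
    by (simp add: PX symplectic_def)
qed

lemma matrix_inv_mat_1: "matrix_inv (mat 1 :: real^'n^'n) = mat 1"
  using matrix_inv_works(1)[of "mat 1 :: real^'n^'n"] by (auto simp: invertible_def)

lemma cayley_0: "cayley 0 = mat 1"
  by (simp add: cayley_def matrix_inv_mat_1 vec_eq_iff)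

lemma continuous_on_cayley:
  "continuous_on {M. invertible (mat 1 - (1/2) *\<^sub>R M)} (cayley :: real^'n^'n \<Rightarrow> _)"
  unfolding cayley_def
  by (intro continuous_intros continuous_on_compose2[OF continuous_on_matrix_inv]) auto

lemma has_derivative_cayley: "((cayley :: real^'n^'n \<Rightarrow> _) has_derivative (\<lambda>H. H)) (at 0)"
proof -
  have i1: "(matrix_inv has_derivative (\<lambda>H. - H)) (at (mat 1 - (1/2) *\<^sub>R (0 :: real^'n^'n)))"
    using has_derivative_matrix_inv[of "mat 1 :: real^'n^'n"]
    by (auto simp: invertible_def matrix_inv_mat_1)
  have "((\<lambda>M :: real^'n^'n. mat 1 - (1/2) *\<^sub>R M) has_derivative (\<lambda>H. - ((1/2) *\<^sub>R H))) (at 0)"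
    by (auto intro!: derivative_eq_intros)
  from has_derivative_compose[OF this i1]
  have inv: "((\<lambda>M :: real^'n^'n. matrix_inv (mat 1 - (1/2) *\<^sub>R M)) has_derivative (\<lambda>H. (1/2) *\<^sub>R H))
      (at 0)"
    by simp
  show ?thesis
    unfolding cayley_def
    using has_derivative_diff[OF has_derivative_scaleR_right[OF inv, of 2]
        has_derivative_const[of "mat 1 :: real^'n^'n"]]
    by simp
qed

section \<open>Graphs and norms\<close>

lemma span_S_mats_graph_of:
  assumes "B \<in> span (S_mats (graph_of N))" "N \<in> Symm"
  shows "B \<in> Symm" and "\<And>i j. i \<noteq> j \<Longrightarrow> N $ i $ j = 0 \<Longrightarrow> B $ i $ j = 0"
proof -
  have sym: "N $ i $ j = N $ j $ i" for i j
    using assms(2) unfolding Symm_def by (metis (mono_tags) mem_Collect_eq transpose_def vec_lambda_beta)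
  let ?V = "{B \<in> Symm. \<forall>i j. i \<noteq> j \<longrightarrow> N $ i $ j = 0 \<longrightarrow> B $ i $ j = 0}"
  have "{i, j} \<notin> graph_of N" if "N $ i $ j = 0" for i j
    using that sym[of i j] by (auto simp: graph_of_def doubleton_eq_iff)
  then have "S_mats (graph_of N) \<subseteq> ?V"
    by (auto simp: S_mats_def)
  moreover have "subspace ?V"
    using subspace_Symm by (auto simp: subspace_def)
  ultimately have "B \<in> ?V"
    using assms(1) span_minimal by blast
  then show "B \<in> Symm" and "\<And>i j. i \<noteq> j \<Longrightarrow> N $ i $ j = 0 \<Longrightarrow> B $ i $ j = 0"
    by auto
qed

text \<open>A perturbation smaller than every nonzero entry of \<open>N\<close> in modulus keeps these entries nonzero,
  while the zero pattern survives because \<open>B\<close> has it too.\<close>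

lemma graph_of_perturbation:
  fixes N :: "real^'n^'n"
  assumes "N \<in> Symm"
  obtains d where "d > 0"
    "\<And>B. B \<in> span (S_mats (graph_of N)) \<Longrightarrow> norm B < d \<Longrightarrow> graph_of (N + B) = graph_of N"
proof -
  \<comment> \<open>The value \<open>1\<close> at the zero entries only keeps the minimum below positive.\<close>
  define e where "e i j = (if N $ i $ j = 0 then 1 else \<bar>N $ i $ j\<bar>)" for i j
  have e: "e i j > 0" "N $ i $ j \<noteq> 0 \<Longrightarrow> e i j \<le> \<bar>N $ i $ j\<bar>" for i j
    by (simp_all add: e_def)
  define d where "d = Min (range (\<lambda>(i, j). e i j))"
  have "d > 0"
    using e(1) by (auto simp: d_def)
  moreover have "graph_of (N + B) = graph_of N"
    if B: "B \<in> span (S_mats (graph_of N))" "norm B < d" for B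
  proof -
    have "(N + B) $ i $ j = 0 \<longleftrightarrow> N $ i $ j = 0" if "i \<noteq> j" for i j
    proof (cases "N $ i $ j = 0")
      case True
      then show ?thesis using span_S_mats_graph_of(2)[OF B(1) assms that] by simp
    next
      case False
      have "\<bar>B $ i $ j\<bar> \<le> norm B"
        using component_le_norm_cart[of "B $ i" j] Finite_Cartesian_Product.norm_nth_le[where x = B and i = i] by linarith
      also have "\<dots> < d" by (rule B)
      also have "d \<le> e i j"
        unfolding d_def by (rule Min_le) (auto intro: image_eqI[of _ _ "(i, j)"])
      also have "\<dots> \<le> \<bar>N $ i $ j\<bar>"
        using e(2) False by simp
      finally show ?thesis using False by auto
    qed
    then show ?thesis by (auto simp: graph_of_def)
  qed
  ultimately show thesis using that by blast
qed

text \<open>A norm is convex, hence continuous, so it attains its extrema on the Euclidean unit sphere; these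
  are the two constants.\<close>

lemma vector_norm_equivalent:
  fixes \<nu> :: "real^'n \<Rightarrow> real"
  assumes "vector_norm \<nu>"
  obtains c C where "c > 0" "C > 0" "\<And>x. c * norm x \<le> \<nu> x" "\<And>x. \<nu> x \<le> C * norm x"
proof -
  have z: "\<And>x. \<nu> x = 0 \<longleftrightarrow> x = 0" and s: "\<And>c x. \<nu> (c *\<^sub>R x) = \<bar>c\<bar> * \<nu> x"
    and t: "\<And>x y. \<nu> (x + y) \<le> \<nu> x + \<nu> y"
    using assms by (auto simp: vector_norm_def)
  have nn: "\<nu> x \<ge> 0" for x
    using t[of x "- x"] s[of "-1" x] z[of 0] by simp
  have "convex_on UNIV \<nu>"
  proof (rule convex_onI)
    fix u :: real and x y
    assume "0 < u" "u < 1"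
    then show "\<nu> ((1 - u) *\<^sub>R x + u *\<^sub>R y) \<le> (1 - u) * \<nu> x + u * \<nu> y"
      using t[of "(1 - u) *\<^sub>R x" "u *\<^sub>R y"] s[of "1 - u" x] s[of u y] by simp
  qed simp
  then have cont: "continuous_on (sphere 0 1) \<nu>"
    using convex_on_continuous continuous_on_subset open_UNIV by blast
  have ne: "sphere (0 :: real^'n) 1 \<noteq> {}"
    by simp
  obtain a where a: "norm a = 1" "\<And>y. norm y = 1 \<Longrightarrow> \<nu> a \<le> \<nu> y"
    using continuous_attains_inf[OF compact_sphere ne cont] by auto
  obtain b where b: "norm b = 1" "\<And>y. norm y = 1 \<Longrightarrow> \<nu> y \<le> \<nu> b"
    using continuous_attains_sup[OF compact_sphere ne cont] by auto
  have "\<nu> a > 0" "\<nu> b > 0"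
    using a(1) b(1) nn z by (metis norm_zero zero_neq_one order_le_less)+
  moreover have "\<nu> a * norm x \<le> \<nu> x" "\<nu> x \<le> \<nu> b * norm x" for x
  proof -
    have *: "\<nu> x = norm x * \<nu> ((1 / norm x) *\<^sub>R x)" if "x \<noteq> 0"
      using that by (simp add: s)
    show "\<nu> a * norm x \<le> \<nu> x" "\<nu> x \<le> \<nu> b * norm x"
      using * a(2)[of "(1 / norm x) *\<^sub>R x"] b(2)[of "(1 / norm x) *\<^sub>R x"] z[of 0]
      by (cases "x = 0"; simp add: mult.commute)+
  qed
  ultimately show thesis using that by blast
qed

text \<open>Applying \<open>A\<close> to the basis vectors, rescaled to \<open>\<nu>\<close>-length \<open>1\<close>, bounds every entry of \<open>A\<close> by a
  multiple of \<open>\<mu> A\<close>.\<close>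

lemma induced_matrix_norm_dominates:
  fixes \<mu> :: "real^'n^'n \<Rightarrow> real"
  assumes "induced_matrix_norm \<mu>"
  obtains K where "K > 0" "\<And>A. norm A \<le> K * \<mu> A"
proof -
  obtain \<nu> where \<nu>: "vector_norm \<nu>" and \<mu>: "\<And>A. \<mu> A = (SUP x\<in>{x. \<nu> x = 1}. \<nu> (A *v x))"
    using assms unfolding induced_matrix_norm_def by blast
  obtain c C where c: "c > 0" "C > 0" "\<And>x. c * norm x \<le> \<nu> x" "\<And>x. \<nu> x \<le> C * norm x"
    using vector_norm_equivalent[OF \<nu>] by blast
  have s: "\<And>c x. \<nu> (c *\<^sub>R x) = \<bar>c\<bar> * \<nu> x"
    using \<nu> by (auto simp: vector_norm_def)
  \<comment> \<open>The supremum that defines \<open>\<mu> A\<close> bounds its members only if they are bounded above.\<close>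
  have bdd: "bdd_above ((\<lambda>x. \<nu> (A *v x)) ` {x. \<nu> x = 1})" for A :: "real^'n^'n"
  proof (rule bdd_aboveI2)
    fix x assume "x \<in> {x. \<nu> x = 1}"
    then have x: "norm x \<le> 1 / c"
      using c(1) c(3)[of x] by (simp add: field_simps)
    have "\<nu> (A *v x) \<le> C * norm (A *v x)" by (rule c)
    also have "\<dots> \<le> C * (onorm ((*v) A) * norm x)"
      using c(2) onorm[OF matrix_vector_mul_bounded_linear] by simp
    also have "\<dots> \<le> C * (onorm ((*v) A) * (1 / c))"
      using c(2) x by (intro mult_left_mono) (auto intro: onorm_pos_le matrix_vector_mul_bounded_linear)
    finally show "\<nu> (A *v x) \<le> C * (onorm ((*v) A) * (1 / c))" .
  qed
  have entry: "\<bar>A $ i $ j\<bar> \<le> C / c * \<mu> A" for A :: "real^'n^'n" and i j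
  proof -
    let ?e = "axis j 1 :: real^'n"
    have e: "\<nu> ?e > 0" "\<nu> ?e \<le> C"
      using c(1) c(3)[of ?e] c(4)[of ?e] by auto
    have "\<nu> (A *v ((1 / \<nu> ?e) *\<^sub>R ?e)) \<le> \<mu> A"
      unfolding \<mu> using e by (intro cSUP_upper[OF _ bdd]) (simp add: s)
    then have le: "\<nu> (A *v ?e) \<le> \<nu> ?e * \<mu> A"
      using e by (simp add: matrix_vector_mult_scaleR s field_simps)
    have "0 \<le> \<nu> (A *v ?e)"
      using c(1) c(3)[of "A *v ?e"] by (meson mult_nonneg_nonneg norm_ge_zero less_imp_le order_trans)
    with le e have "0 \<le> \<mu> A"
      by (meson order_trans zero_le_mult_iff linorder_not_le)
    have "\<bar>A $ i $ j\<bar> = \<bar>(A *v ?e) $ i\<bar>"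
      by (simp add: matrix_vector_mul_component inner_axis)
    also have "\<dots> \<le> norm (A *v ?e)"
      by (rule component_le_norm_cart)
    also have "\<dots> \<le> \<nu> (A *v ?e) / c"
      using c(1) c(3)[of "A *v ?e"] by (simp add: field_simps)
    also have "\<dots> \<le> (C * \<mu> A) / c"
      using le e \<open>0 \<le> \<mu> A\<close> c(1)
      by (intro divide_right_mono) (auto intro: order_trans mult_right_mono)
    finally show ?thesis by simp
  qed
  have "norm A \<le> (real CARD('n) * real CARD('n) * (C / c)) * \<mu> A" for A :: "real^'n^'n"
  proof -
    have "norm A \<le> (\<Sum>i\<in>UNIV. norm (A $ i))"
      by (simp add: norm_vec_def L2_set_le_sum)
    also have "\<dots> \<le> (\<Sum>i\<in>UNIV. \<Sum>j\<in>UNIV. \<bar>A $ i $ j\<bar>)"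
      by (intro sum_mono norm_le_l1_cart)
    also have "\<dots> \<le> (\<Sum>i::'n\<in>UNIV. \<Sum>j::'n\<in>UNIV. C / c * \<mu> A)"
      by (intro sum_mono entry)
    finally show ?thesis by simp
  qed
  moreover have "real CARD('n) * real CARD('n) * (C / c) > 0"
    using c by simp
  ultimately show thesis using that by blast
qed

section \<open>The bifurcation theorem\<close>

lemma pos_def_congruence_cancel:
  fixes A S S' :: "real^'n^'n"
  assumes "pos_def (transpose S ** A ** S)" "A \<in> Symm" "S ** S' = mat 1"
  shows "pos_def A"
  unfolding pos_def_def
proof (intro conjI allI impI assms(2))
  fix x :: "real^'n"
  assume "x \<noteq> 0"
  have x: "S *v (S' *v x) = x"
    by (simp add: matrix_vector_mul_assoc assms(3))
  with \<open>x \<noteq> 0\<close> have "S' *v x \<noteq> 0"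
    by auto
  then have "0 < (S' *v x) \<bullet> ((transpose S ** A ** S) *v (S' *v x))"
    using assms(1) unfolding pos_def_def by blast
  also have "\<dots> = (S' *v x) \<bullet> (transpose S *v (A *v x))"
    by (simp add: x del: transpose_matrix_vector flip: matrix_vector_mul_assoc)
  also have "\<dots> = x \<bullet> (A *v x)"
    by (metis dot_lmul_matrix inner_commute transpose_matrix_vector x)
  finally show "0 < x \<bullet> (A *v x)" .
qed

text \<open>The SSSP solves \<open>N ** M + transpose M ** N + B = A\<close> for each symmetric \<open>A\<close>; linear algebra makes
  the choice of \<open>M\<close> and \<open>B\<close> linear in \<open>A\<close>. Composed with such a choice, the parametrization of
  congruences has derivative \<open>A \<mapsto> A\<close> on the symmetric matrices.\<close>

lemma SSSP_linear_solution:
  fixes N :: "'p::finite sqmat2"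
  assumes "SSSP N"
  shows "\<exists>m k. linear m \<and> linear k \<and> (\<forall>A. Omega ** m A \<in> Symm) \<and>
    (\<forall>A. k A \<in> span (S_mats (graph_of N))) \<and>
    (\<forall>A \<in> Symm. N ** m A + transpose (m A) ** N + k A = A)"
proof -
  define L where "L = (\<lambda>(M, B). N ** M + transpose M ** N + B)"
  let ?V = "{M. Omega ** M \<in> Symm} \<times> span (S_mats (graph_of N))"
  have "linear L"
    unfolding linear_iff L_def
    by (auto simp: matrix_mult.add_left matrix_mult.add_right matrix_mult.scaleR_left
        matrix_mult.scaleR_right transpose_add transpose_scalar algebra_simps)
  moreover have "subspace ?V"
    by (intro subspace_Times subspace_Omega_mult_Symm subspace_span)
  ultimately obtain g where g: "range g \<subseteq> ?V" "linear g" "\<And>A. A \<in> L ` ?V \<Longrightarrow> L (g A) = A"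
    using linear_exists_right_inverse_on by blast
  have "Symm \<subseteq> L ` ?V"
  proof
    fix A :: "'p sqmat2"
    assume "A \<in> Symm"
    then obtain M B where "M \<in> hamiltonian_mats" "B \<in> span (S_mats (graph_of N))"
      "A = N ** M + transpose M ** N + B"
      using assms unfolding SSSP_def set_plus_def by blast
    then show "A \<in> L ` ?V"
      using hamiltonian_imp_Omega_mult_Symm by (intro image_eqI[of _ _ "(M, B)"]) (auto simp: L_def)
  qed
  then have "N ** fst (g A) + transpose (fst (g A)) ** N + snd (g A) = A" if "A \<in> Symm" for A
    using g(3)[of A] that by (auto simp: L_def split_beta)
  moreover have "linear (fst \<circ> g)" "linear (snd \<circ> g)"
    using g(2) by (auto intro!: linear_compose simp: linear_fst linear_snd)
  moreover have "Omega ** fst (g A) \<in> Symm" "snd (g A) \<in> span (S_mats (graph_of N))" for A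
    using g(1) by (auto simp: image_subset_iff mem_Times_iff)
  ultimately show ?thesis
    by (intro exI[of _ "fst \<circ> g"] exI[of _ "snd \<circ> g"]) simp
qed

text \<open>The open mapping theorem needs all matrices, not only the symmetric ones, as codomain. So the
  symmetric part of the parameter \<open>A\<close> drives the congruence, while its skew part is added to the
  value: the derivative at \<open>0\<close> is then the identity on all matrices, and when the value is symmetric
  the skew part of \<open>A\<close> must vanish.\<close>

lemma SSSP_local_normal_form:
  fixes N :: "'p::finite sqmat2"
  assumes N: "N \<in> Symm" and "SSSP N" and d: "d > 0"
  obtains e where "e > 0" "\<And>N_hat. N_hat \<in> Symm \<Longrightarrow> norm (N_hat - N) < e \<Longrightarrow>
    \<exists>S B. symplectic S \<and> B \<in> span (S_mats (graph_of N)) \<and> norm B < d \<and>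
      N_hat = transpose S ** (N + B) ** S"
proof -
  obtain m k where m: "linear m" and k: "linear k" and m_in: "\<And>A. Omega ** m A \<in> Symm"
    and k_in: "\<And>A. k A \<in> span (S_mats (graph_of N))"
    and mk: "\<And>A. A \<in> Symm \<Longrightarrow> N ** m A + transpose (m A) ** N + k A = A"
    using SSSP_linear_solution[OF \<open>SSSP N\<close>] by auto
  define sym skew :: "'p sqmat2 \<Rightarrow> 'p sqmat2"
    where "sym = (\<lambda>A. (1/2) *\<^sub>R (A + transpose A))"
      and "skew = (\<lambda>A. (1/2) *\<^sub>R (A - transpose A))"
  define M B where "M = (\<lambda>A. m (sym A))" and "B = (\<lambda>A. k (sym A))"
  define f where "f = (\<lambda>A. transpose (cayley (M A)) ** (N + B A) ** cayley (M A) + skew A)"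
  have sym_in: "sym A \<in> Symm" for A
    by (simp add: sym_def Symm_def transpose_add transpose_scalar add.commute)
  have bl_sym: "bounded_linear sym" and bl_skew: "bounded_linear skew"
    unfolding sym_def skew_def
    by (intro bounded_linear_const_scaleR bounded_linear_add bounded_linear_sub bounded_linear_ident
        bounded_linear_transpose)+
  have bl_M: "bounded_linear M" and bl_B: "bounded_linear B"
    unfolding M_def B_def
    using bounded_linear_compose[OF _ bl_sym] m k
    by (simp_all add: linear_conv_bounded_linear)
  have M0: "M 0 = 0" and B0: "B 0 = 0"
    using bl_M bl_B by (simp_all add: linear_0 bounded_linear.linear)
  \<comment> \<open>On this open set the Cayley transform is defined and \<open>B A\<close> is as small as required.\<close>
  define U where "U = {A. invertible (mat 1 - (1/2) *\<^sub>R M A) \<and> norm (B A) < d}"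
  have cont_M: "continuous_on S M" and cont_B: "continuous_on S B" and cont_skew: "continuous_on S skew"
    for S
    using bl_M bl_B bl_skew by (simp_all add: linear_continuous_on)
  have "open ((\<lambda>A. mat 1 - (1/2) *\<^sub>R M A) -` {P. invertible P} \<inter> (\<lambda>A. norm (B A)) -` {..<d})"
    by (intro open_Int open_vimage open_invertible continuous_intros cont_M cont_B) auto
  then have "open U"
    by (simp add: U_def vimage_def Int_def)
  have "0 \<in> U"
    using d by (auto simp: U_def M0 B0 invertible_def)
  have cay: "continuous_on U (\<lambda>A. cayley (M A))"
    by (intro continuous_on_compose2[OF continuous_on_cayley cont_M]) (auto simp: U_def)
  have "continuous_on U f"
    unfolding f_def
    by (intro continuous_intros matrix_mult.continuous_on bounded_linear.continuous_on[OF bounded_linear_transpose] cay cont_B cont_skew)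
  moreover have "(f has_derivative id) (at 0)"
  proof -
    have "((\<lambda>A. cayley (M A)) has_derivative M) (at 0)"
      using has_derivative_compose[OF bounded_linear_imp_has_derivative[OF bl_M], of cayley "\<lambda>H. H" 0]
        has_derivative_cayley by (simp add: M0)
    note D = this bounded_linear.has_derivative[OF bounded_linear_transpose this]
      bounded_linear_imp_has_derivative[OF bl_B] bounded_linear_imp_has_derivative[OF bl_skew]
    have "(f has_derivative (\<lambda>H. (transpose (M H) ** N + B H) + N ** M H + skew H)) (at 0)"
      unfolding f_def
      using has_derivative_add[OF matrix_mult.FDERIV[OF matrix_mult.FDERIV[OF D(2)
            has_derivative_add[OF has_derivative_const[of N] D(3)]] D(1)] D(4)]
      by (rule has_derivative_eq_rhs) (auto simp: M0 B0 cayley_0 fun_eq_iff algebra_simps)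
    moreover have "(transpose (M H) ** N + B H) + N ** M H + skew H = H" for H
    proof -
      have "(transpose (M H) ** N + B H) + N ** M H + skew H = sym H + skew H"
        using mk[OF sym_in, of H] by (simp add: M_def B_def algebra_simps)
      also have "\<dots> = H"
        by (simp add: sym_def skew_def vec_eq_iff field_simps)
      finally show ?thesis .
    qed
    ultimately show ?thesis by (simp add: id_def)
  qed
  ultimately have "f 0 \<in> interior (f ` U)"
    using \<open>open U\<close> \<open>0 \<in> U\<close>
    by (intro sussmann_open_mapping[where f' = id and g' = id and S = U])
      (auto simp: interior_open id_def bounded_linear_ident)
  moreover have "f 0 = N"
    by (simp add: f_def M0 B0 cayley_0 skew_def transpose_zero)
  ultimately obtain e where e: "e > 0" "ball N e \<subseteq> f ` U"
    unfolding mem_interior by auto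
  have "\<exists>S B. symplectic S \<and> B \<in> span (S_mats (graph_of N)) \<and> norm B < d \<and>
      N_hat = transpose S ** (N + B) ** S"
    if Nh: "N_hat \<in> Symm" "norm (N_hat - N) < e" for N_hat
  proof -
    have "N_hat \<in> ball N e"
      using Nh(2) by (simp add: dist_norm norm_minus_commute)
    then obtain A where A: "A \<in> U" "N_hat = f A"
      using e(2) by auto
    let ?S = "cayley (M A)"
    have BA: "B A \<in> span (S_mats (graph_of N))"
      using k_in by (simp add: B_def)
    have tB: "transpose (N + B A) = N + B A"
      using N span_S_mats_graph_of(1)[OF BA N] by (simp add: Symm_def transpose_add)
    have tskew: "transpose (skew A) = - skew A"
      by (simp add: skew_def transpose_diff transpose_scalar flip: scaleR_minus_right)
    have "transpose N_hat = transpose ?S ** (N + B A) ** ?S - skew A"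
      by (simp add: A(2) f_def transpose_add tskew matrix_transpose_mul matrix_mul_assoc
          tB[unfolded transpose_add])
    moreover have "transpose N_hat = N_hat"
      using Nh(1) by (simp add: Symm_def)
    ultimately have "skew A = - skew A"
      by (simp add: A(2) f_def)
    then have "skew A = 0"
      by (simp add: eq_neg_iff_add_eq_0 vec_eq_iff)
    then have "N_hat = transpose ?S ** (N + B A) ** ?S"
      by (simp add: A(2) f_def)
    moreover have "symplectic ?S"
      using A(1) m_in by (intro symplectic_cayley) (auto simp: U_def M_def)
    ultimately show ?thesis
      using BA A(1) by (auto simp: U_def)
  qed
  then show thesis using that e(1) by blast
qed

theorem theorem3p17:
  fixes N :: "real^('p::finite + 'p)^('p + 'p)"
    and mnorm :: "real^('p + 'p)^('p + 'p) \<Rightarrow> real"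
  assumes "induced_matrix_norm mnorm"
    and "pos_def N"
    and "SSSP N"
  shows "\<exists>\<epsilon>>0. \<forall>N_hat. pos_def N_hat \<and> mnorm (N_hat - N) < \<epsilon> \<longrightarrow>
    (\<exists>N' \<in> S_plus (graph_of N). symplectic_spectrum N' = symplectic_spectrum N_hat)"
proof -
  have N: "N \<in> Symm"
    using assms(2) by (simp add: pos_def_def)
  obtain K where K: "K > 0" "\<And>A. norm A \<le> K * mnorm A"
    using induced_matrix_norm_dominates[OF assms(1)] by blast
  obtain d where d: "d > 0" "\<And>B. B \<in> span (S_mats (graph_of N)) \<Longrightarrow> norm B < d \<Longrightarrow>
      graph_of (N + B) = graph_of N"
    using graph_of_perturbation[OF N] by blast
  obtain e where e: "e > 0" "\<And>N_hat. N_hat \<in> Symm \<Longrightarrow> norm (N_hat - N) < e \<Longrightarrow>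
      \<exists>S B. symplectic S \<and> B \<in> span (S_mats (graph_of N)) \<and> norm B < d \<and>
        N_hat = transpose S ** (N + B) ** S"
    using SSSP_local_normal_form[OF N assms(3) d(1)] by blast
  show ?thesis
  proof (intro exI[of _ "e / K"] conjI allI impI)
    show "e / K > 0"
      using e(1) K(1) by simp
    fix N_hat
    assume Nh: "pos_def N_hat \<and> mnorm (N_hat - N) < e / K"
    then have "norm (N_hat - N) < e"
      using K(1) K(2)[of "N_hat - N"] by (simp add: field_simps)
    moreover have "N_hat \<in> Symm"
      using Nh by (simp add: pos_def_def)
    ultimately obtain S B where S: "symplectic S" and B: "B \<in> span (S_mats (graph_of N))" "norm B < d"
      and eq: "N_hat = transpose S ** (N + B) ** S"
      using e(2) by blast
    obtain S' where "S ** S' = mat 1"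
      using symplectic_inverse[OF S] by blast
    moreover have "N + B \<in> Symm"
      using N span_S_mats_graph_of(1)[OF B(1) N] subspace_Symm subspace_add by blast
    ultimately have "pos_def (N + B)"
      using Nh eq pos_def_congruence_cancel by blast
    then have "N + B \<in> S_plus (graph_of N)"
      using d(2)[OF B] by (simp add: S_plus_def)
    moreover have "symplectic_spectrum (N + B) = symplectic_spectrum N_hat"
      using symplectic_spectrum_congruence[OF S] eq by simp
    ultimately show "\<exists>N' \<in> S_plus (graph_of N). symplectic_spectrum N' = symplectic_spectrum N_hat"
      by blast
  qed
qed

end
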